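(* Let $d \geq 2$ be an integer, $\Delta = d+1$, and $\lambda \in \mathbb{C}$. If there is a convex set $S \subset \mathbb{C}$ with $0 \in S$ and $-1 \notin S$ such that $f(z) = \frac{\lambda}{(1+z)^d} \in S$ for every $z \in S$, then $Z_G(\lambda) \neq 0$ for every graph $G \in \mathcal{G}_\Delta$.
   Context: For a finite graph $G$, $Z_G(\lambda) = \sum_{I} \lambda^{|I|}$, the sum over all independent sets $I$ of $G$ (including the empty set). $\mathcal{G}_\Delta$ denotes the set of finite graphs with all vertex degrees at most $\Delta$. *)

theory Defs
  imports "Graph_Theory.Digraph" "HOL-Analysis.Analysis"
begin

definition indep_set :: "('a, 'b) pre_digraph \<Rightarrow> 'a set \<Rightarrow> bool" where
  "indep_set G I \<longleftrightarrow> I \<subseteq> verts G \<and> (\<forall>u\<in>I. \<forall>v\<in>I. \<not> u \<rightarrow>\<^bsub>G\<^esub> v)"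

definition indep_poly :: "('a, 'b) pre_digraph \<Rightarrow> complex \<Rightarrow> complex" where
  "indep_poly G x = (\<Sum>I | indep_set G I. x ^ card I)"

text \<open>
  The locale \<^locale>\<open>graph\<close> describes finite simple undirected graphs as symmetric digraphs
  without loops and parallel arcs; an undirected edge is a pair of opposite arcs, so the degree
  of a vertex is its out-degree.
\<close>

definition bounded_degree_graphs :: "nat \<Rightarrow> ('a, 'b) pre_digraph set" where
  "bounded_degree_graphs \<Delta> = {G. graph G \<and> (\<forall>v\<in>verts G. out_degree G v \<le> \<Delta>)}"

end

theory Submission
  imports Defs
begin

text \<open>
  Let \<open>R\<close> be the ratio of the contributions of the independent sets with and without a given
  vertex. Removing the neighbours of the vertex one at a time gives \<open>R = \<lambda> / \<Prod>(1 + R\<^sub>i)\<close>, where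
  each \<open>R\<^sub>i\<close> is the ratio of a vertex with at most \<open>d\<close> remaining neighbours. So all ratios are
  values of rooted trees.

  These values stay in \<open>S\<close>: in logarithmic coordinates a line avoiding the origin is the graph of
  a convex function, so the geometric mean of points of the convex set \<open>1 + S\<close> is \<open>t w\<close> with
  \<open>t \<ge> 1\<close> and \<open>w \<in> 1 + S\<close>. Hence \<open>\<lambda> / \<Prod>(1 + z\<^sub>i) = t\<^sup>-\<^sup>d f(w - 1)\<close>, which lies in \<open>S\<close>
  because \<open>0 \<in> S\<close>.

  A vertex with \<open>d + 1\<close> neighbours could still have ratio \<open>-1\<close>. For the tree realising its ratio this is
  excluded by moving the root to a leaf, whose ratio lies in \<open>S\<close> and so differs from \<open>-1\<close>.
\<close>

section \<open>Geometric means in convex sets\<close>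

text \<open>The sequence \<open>sin (k * t)\<close> is concave in \<open>k\<close> and starts at 0,
  so \<open>sin (k * t) / k\<close> decreases. Concavity is the identity for
  \<open>sin (x + t) + sin (x - t)\<close> with \<open>cos t\<close> bounded by 1.\<close>

lemma sin_multiple_mono:
  fixes t :: real
  assumes "0 \<le> t" "real (Suc n) * t \<le> pi"
  shows "real n * sin (real (Suc n) * t) \<le> real (Suc n) * sin (real n * t)"
  using assms(2)
proof (induction n)
  case (Suc n)
  have le: "real (Suc n) * t \<le> pi"
    using Suc.prems assms(1) by (simp add: algebra_simps)
  have IH: "real n * sin (real (Suc n) * t) \<le> real (Suc n) * sin (real n * t)"
    using Suc.IH le by simp
  have pos: "0 \<le> sin (real (Suc n) * t)"
    using le assms(1) by (intro sin_ge_zero) auto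
  have "sin (real (Suc (Suc n)) * t) + sin (real n * t) = 2 * cos t * sin (real (Suc n) * t)"
  proof -
    have "real (Suc (Suc n)) * t = real (Suc n) * t + t" "real n * t = real (Suc n) * t - t"
      by (simp_all add: algebra_simps)
    then show ?thesis by (simp only: sin_add sin_diff) simp
  qed
  also have "\<dots> \<le> 2 * sin (real (Suc n) * t)"
    using pos cos_le_one[of t] by (simp add: mult_left_le_one_le mult_right_mono)
  finally have "real (Suc n) * sin (real (Suc (Suc n)) * t)
      \<le> real (Suc n) * (2 * sin (real (Suc n) * t) - sin (real n * t))"
    by (intro mult_left_mono) auto
  then show ?case using IH by (simp add: algebra_simps)
qed simp

lemma sin_multiple_le:
  fixes t :: real
  assumes "0 \<le> t" "real n * t \<le> pi"
  shows "sin (real n * t) \<le> real n * sin t"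
  using assms(2)
proof (induction n)
  case (Suc n)
  have nt: "real n * t \<le> pi"
    using Suc.prems assms(1) by (simp add: algebra_simps)
  have s: "0 \<le> sin t" if "n > 0"
  proof (rule sin_ge_zero)
    have "1 * t \<le> real n * t" using that assms(1) by (intro mult_right_mono) auto
    then show "t \<le> pi" using nt by simp
  qed (use assms in auto)
  have n0: "0 \<le> sin (real n * t)" using nt assms(1) by (intro sin_ge_zero) auto
  show ?case
  proof (cases "n = 0")
    case False
    have "sin (real (Suc n) * t) = sin (real n * t) * cos t + cos (real n * t) * sin t"
      by (simp add: distrib_right sin_add)
    also have "\<dots> \<le> sin (real n * t) + sin t"
      using n0 s False mult_right_mono[OF cos_le_one, of "sin t" "real n * t"]
      by (intro add_mono) (auto simp: mult_left_le)
    finally show ?thesis using Suc.IH nt by (simp add: algebra_simps)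
  qed simp
qed simp

text \<open>This is AM-GM for one copy of 1 and \<open>m - 1\<close> copies of \<open>r\<close>. It
  follows from Bernoulli's inequality at \<open>1 / r\<close>, scaled by
  \<open>r ^ m\<close>.\<close>

lemma bernoulli_power_bound:
  fixes r :: real
  assumes "r > 0" "m > 0"
  shows "r ^ (m - 1) \<le> ((1 + r * real (m - 1)) / real m) ^ m"
proof -
  define y where "y = 1 / r"
  have "y > 0" "real m \<ge> 1" using assms by (auto simp: y_def)
  then have "- 1 * real m \<le> y - 1" by linarith
  then have "- 1 \<le> (y - 1) / real m" using assms by (simp add: pos_le_divide_eq)
  then have "1 + real m * ((y - 1) / real m) \<le> (1 + (y - 1) / real m) ^ m"
    by (rule Bernoulli_inequality)
  then have "y \<le> (1 + (y - 1) / real m) ^ m" using assms by simp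
  then have "r ^ m * y \<le> r ^ m * (1 + (y - 1) / real m) ^ m"
    using assms by (intro mult_left_mono) auto
  also have "\<dots> = (r * (1 + (y - 1) / real m)) ^ m" by (simp add: power_mult_distrib)
  also have "r * (1 + (y - 1) / real m) = (1 + r * real (m - 1)) / real m"
    using assms by (simp add: y_def field_simps of_nat_diff)
  also have "r ^ m * y = r ^ (m - 1)"
    using assms by (cases m) (auto simp: y_def)
  finally show ?thesis .
qed

text \<open>
  Here \<open>w = q e\<^sup>i\<^sup>\<phi>\<close> is the point where the ray of argument \<open>\<phi> = \<theta> / m\<close> meets the segment; its
  modulus \<open>q\<close> comes from comparing areas of triangles.
\<close>
lemma root_in_segment_upper:
  fixes r \<theta> :: real
  assumes "r > 0" "0 < \<theta>" "\<theta> < pi" "m > 0"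
  shows "\<exists>w\<in>closed_segment 1 (rcis r \<theta>). \<exists>c\<ge>1. rcis r \<theta> = of_real c * w ^ m"
proof -
  define \<phi> where "\<phi> = \<theta> / real m"
  have th: "\<theta> = real m * \<phi>" using assms by (simp add: \<phi>_def)
  have phi: "0 < \<phi>" "\<phi> \<le> \<theta>"
    using assms by (auto simp: \<phi>_def field_simps)
  have s\<theta>: "0 < sin \<theta>" using assms by (intro sin_gt_zero) auto
  have s\<phi>: "0 < sin \<phi>" using phi assms by (intro sin_gt_zero) auto
  have sd: "0 \<le> sin (\<theta> - \<phi>)" using phi assms by (intro sin_ge_zero) auto
  have diff: "\<theta> - \<phi> = real (m - 1) * \<phi>"
    using assms by (simp add: th of_nat_diff algebra_simps)
  \<comment> \<open>The triangle 0, 1, \<open>rcis r \<theta>\<close> has twice the area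
    \<open>r * sin \<theta>\<close>. The ray cuts it into two triangles of total doubled area
    \<open>q * D\<close>, which gives \<open>q\<close>.\<close>
  define D where "D = sin \<phi> + r * sin (\<theta> - \<phi>)"
  have D: "0 < D" using s\<phi> sd assms by (auto simp: D_def intro!: add_pos_nonneg)
  define q where "q = r * sin \<theta> / D"
  have q: "0 < q" using D s\<theta> assms by (simp add: q_def)
  define w where "w = rcis q \<phi>"
  have seg: "w \<in> closed_segment 1 (rcis r \<theta>)"
  proof -
    \<comment> \<open>The share of the triangle 0, 1, \<open>w\<close> in the whole area.\<close>
    define u where "u = sin \<phi> / D"
    have u: "0 \<le> u" "u \<le> 1" using D s\<phi> sd assms by (auto simp: u_def D_def field_simps)
    have u1: "1 - u = r * sin (\<theta> - \<phi>) / D" using D by (simp add: u_def D_def field_simps)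
    have "w = (1 - u) *\<^sub>R 1 + u *\<^sub>R rcis r \<theta>"
    proof (rule complex_eqI)
      have "r * sin \<theta> * cos \<phi> = r * sin (\<theta> - \<phi>) + sin \<phi> * (r * cos \<theta>)"
        by (simp add: sin_diff algebra_simps)
      then show "Re w = Re ((1 - u) *\<^sub>R 1 + u *\<^sub>R rcis r \<theta>)"
        unfolding u1 using D by (simp add: w_def q_def u_def rcis_def field_simps)
      show "Im w = Im ((1 - u) *\<^sub>R 1 + u *\<^sub>R rcis r \<theta>)"
        using D by (simp add: w_def q_def u_def rcis_def field_simps)
    qed
    then show ?thesis using u by (auto simp: in_segment)
  qed
  \<comment> \<open>The goal \<open>q ^ m \<le> r\<close> means
    \<open>(r * sin \<theta>) ^ m \<le> r * D ^ m\<close>. Bounding both sines in \<open>D\<close>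
    below by multiples of \<open>sin \<theta>\<close> reduces it to
    \<open>bernoulli_power_bound\<close>.\<close>
  have le1: "sin \<theta> \<le> real m * sin \<phi>"
    using sin_multiple_le[of \<phi> m] phi assms by (simp add: th)
  have le2: "real (m - 1) * sin \<theta> \<le> real m * sin (\<theta> - \<phi>)"
    using sin_multiple_mono[of \<phi> "m - 1"] phi assms by (simp add: th[symmetric] diff)
  have "sin \<theta> * (1 + r * real (m - 1)) = sin \<theta> + r * (real (m - 1) * sin \<theta>)"
    by (simp add: algebra_simps)
  also have "\<dots> \<le> real m * sin \<phi> + r * (real m * sin (\<theta> - \<phi>))"
    using le1 le2 assms by (intro add_mono mult_left_mono) auto
  finally have "sin \<theta> * ((1 + r * real (m - 1)) / real m) \<le> D"
    using assms by (simp add: D_def field_simps)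
  then have "(sin \<theta> * ((1 + r * real (m - 1)) / real m)) ^ m \<le> D ^ m"
    using s\<theta> assms by (intro power_mono) auto
  moreover have "sin \<theta> ^ m * r ^ (m - 1) \<le> sin \<theta> ^ m * ((1 + r * real (m - 1)) / real m) ^ m"
    using bernoulli_power_bound[of r m] s\<theta> assms by (intro mult_left_mono) auto
  ultimately have "sin \<theta> ^ m * r ^ (m - 1) \<le> D ^ m"
    unfolding power_mult_distrib by linarith
  then have "r * (sin \<theta> ^ m * r ^ (m - 1)) \<le> r * D ^ m"
    using assms by (intro mult_left_mono) auto
  also have "r * (sin \<theta> ^ m * r ^ (m - 1)) = (r * sin \<theta>) ^ m"
    using assms by (cases m) (auto simp: power_mult_distrib)
  finally have "(r * sin \<theta>) ^ m \<le> r * D ^ m" .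
  then have qm: "q ^ m \<le> r"
    using D by (simp add: q_def power_divide field_simps)
  have "rcis r \<theta> = of_real (r / q ^ m) * w ^ m"
    using q by (simp add: w_def th rcis_def power_mult_distrib Complex.DeMoivre)
  moreover have "1 \<le> r / q ^ m" using qm q by simp
  ultimately show ?thesis using seg by blast
qed

text \<open>Conjugation reduces the lower half plane to the upper one. For real \<open>v > 0\<close>
  an endpoint serves as \<open>w\<close>: 1 if \<open>v\<close> is at least 1, otherwise
  \<open>v\<close> itself, whose power is at most \<open>v\<close>.\<close>

lemma root_in_segment:
  fixes v :: complex
  assumes "v \<notin> \<real>\<^sub>\<le>\<^sub>0" "m > 0"
  shows "\<exists>w\<in>closed_segment 1 v. \<exists>c\<ge>1. v = of_real c * w ^ m"
proof -
  have upper: "\<exists>w\<in>closed_segment 1 v. \<exists>c\<ge>1. v = of_real c * w ^ m" if "Im v > 0" for v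
  proof -
    have v0: "v \<noteq> 0" using that by auto
    then have "0 < Arg v" "Arg v < pi" using Arg_lt_pi that by auto
    then show ?thesis
      using root_in_segment_upper[of "cmod v" "Arg v" m] assms(2) v0
      by (simp add: rcis_cmod_Arg)
  qed
  consider "Im v > 0" | "Im v < 0" | "Im v = 0" by linarith
  then show ?thesis
  proof cases
    case 1
    then show ?thesis by (rule upper)
  next
    case 2
    then obtain w c where w: "w \<in> closed_segment 1 (cnj v)" "c \<ge> 1" "cnj v = of_real c * w ^ m"
      using upper[of "cnj v"] by auto
    have "cnj w \<in> closed_segment 1 v"
    proof -
      obtain u where "0 \<le> u" "u \<le> 1" "w = (1 - u) *\<^sub>R 1 + u *\<^sub>R cnj v"
        using w(1) by (auto simp: in_segment)
      then show ?thesis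
        unfolding in_segment by (intro exI[of _ u]) (simp add: complex_eq_iff)
    qed
    moreover have "v = of_real c * cnj w ^ m"
      using arg_cong[OF w(3), of cnj] by simp
    ultimately show ?thesis using w(2) by blast
  next
    case 3
    then obtain r where v: "v = of_real r" by (metis complex_is_Real_iff Reals_cases)
    then have r: "r > 0" using assms(1) by (metis complex_nonpos_Reals_iff Re_complex_of_real Im_complex_of_real not_le)
    show ?thesis
    proof (cases "r \<ge> 1")
      case True
      then show ?thesis using v by (intro bexI[of _ 1] exI[of _ r]) auto
    next
      case False
      have "r ^ m \<le> r ^ 1" using False r assms(2) by (intro power_decreasing) auto
      moreover have "v = of_real (r / r ^ m) * v ^ m" using r v by simp
      ultimately show ?thesis
        using r by (intro bexI[of _ v] exI[of _ "r / r ^ m"]) auto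
    qed
  qed
qed

text \<open>Dividing by \<open>u\<close> turns the segment from \<open>u\<close> to \<open>v\<close>
  into one from 1 to \<open>v / u\<close>. If \<open>v / u\<close> were a nonpositive real, the
  original segment, and so \<open>W\<close>, would contain 0.\<close>

lemma convex_power_mult:
  fixes W :: "complex set"
  assumes "convex W" "0 \<notin> W" "u \<in> W" "v \<in> W"
  shows "\<exists>w\<in>W. \<exists>c\<ge>1. u ^ n * v = of_real c * w ^ Suc n"
proof -
  have u0: "u \<noteq> 0" using assms by auto
  have seg: "u * x \<in> W" if x: "x \<in> closed_segment 1 (v / u)" for x
  proof -
    obtain t where t: "0 \<le> t" "t \<le> 1" "x = (1 - t) *\<^sub>R 1 + t *\<^sub>R (v / u)"
      using x by (auto simp: in_segment)
    then have "u * x = (1 - t) *\<^sub>R u + t *\<^sub>R v"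
      using u0 by (simp add: distrib_left)
    then show ?thesis using assms t by (auto simp: convex_alt)
  qed
  have "v / u \<notin> \<real>\<^sub>\<le>\<^sub>0"
  proof
    assume "v / u \<in> \<real>\<^sub>\<le>\<^sub>0"
    then obtain r where r: "v / u = of_real r" "r \<le> 0" by (rule nonpos_Reals_cases)
    \<comment> \<open>The solution of \<open>(1 - t) + t * r = 0\<close>.\<close>
    define t where "t = 1 / (1 - r)"
    have "0 = (1 - t) *\<^sub>R 1 + t *\<^sub>R (v / u)"
      using r(2) unfolding r(1) by (simp add: t_def complex_eq_iff field_simps)
    then have "0 \<in> closed_segment 1 (v / u)"
      using r(2) unfolding in_segment by (intro exI[of _ t]) (auto simp: t_def)
    then show False using seg assms(2) by fastforce
  qed
  then obtain w c where w: "w \<in> closed_segment 1 (v / u)" "c \<ge> 1" "v / u = of_real c * w ^ Suc n"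
    using root_in_segment[of "v / u" "Suc n"] by auto
  have "u ^ n * v = u ^ Suc n * (v / u)" using u0 by simp
  also have "\<dots> = of_real c * (u * w) ^ Suc n" unfolding w(3) by (simp add: power_mult_distrib)
  finally show ?thesis using seg[OF w(1)] w(2) by blast
qed

lemma convex_prod_list:
  fixes W :: "complex set"
  assumes "convex W" "0 \<notin> W" "ws \<noteq> []" "set ws \<subseteq> W"
  shows "\<exists>w\<in>W. \<exists>c\<ge>1. prod_list ws = of_real c * w ^ length ws"
  using assms(3,4)
proof (induction ws rule: list_nonempty_induct)
  case (single x)
  then show ?case by (intro bexI[of _ x] exI[of _ 1]) auto
next
  case (cons x xs)
  then obtain w c where w: "w \<in> W" "c \<ge> 1" "prod_list xs = of_real c * w ^ length xs"
    by auto
  obtain w' c' where w': "w' \<in> W" "c' \<ge> 1" "w ^ length xs * x = of_real c' * w' ^ Suc (length xs)"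
    using convex_power_mult[OF assms(1,2) w(1), of x "length xs"] cons.prems
    by (auto simp del: power_Suc)
  have "prod_list (x # xs) = of_real c * (w ^ length xs * x)"
    using w(3) by simp
  also have "\<dots> = of_real (c * c') * w' ^ length (x # xs)"
    unfolding w'(3) by simp
  finally have "prod_list (x # xs) = of_real (c * c') * w' ^ length (x # xs)" .
  moreover have "c * c' \<ge> 1" using w(2) w'(2) mult_mono[of 1 c 1 c'] by simp
  ultimately show ?case using w'(1) by blast
qed

section \<open>Ratios of rooted trees\<close>

text \<open>The list holds the values of the children of the root. The empty list is the single
  vertex, with value \<open>lam\<close>.\<close>

inductive_set tree_ratios :: "nat \<Rightarrow> complex \<Rightarrow> complex set" for d :: nat and lam :: complex where
  node: "\<lbrakk>\<forall>z\<in>set zs. z \<in> tree_ratios d lam; length zs \<le> d\<rbrakk>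
    \<Longrightarrow> lam / (\<Prod>z\<leftarrow>zs. 1 + z) \<in> tree_ratios d lam"

lemma tree_ratios_subset:
  assumes "convex S" "0 \<in> S" "- 1 \<notin> S" "\<And>z. z \<in> S \<Longrightarrow> lam / (1 + z) ^ d \<in> S" "d > 0"
  shows "tree_ratios d lam \<subseteq> S"
proof
  fix t assume "t \<in> tree_ratios d lam"
  then show "t \<in> S"
  proof induction
    case (node zs)
    \<comment> \<open>Padding with \<open>1 = 1 + 0\<close>, where 0 is in \<open>S\<close>, makes
      the number of factors exactly \<open>d\<close> without changing the product.\<close>
    define ws where "ws = map (\<lambda>z. 1 + z) zs @ replicate (d - length zs) 1"
    define W where "W = (\<lambda>z. 1 + z) ` S"
    have W: "convex W" "0 \<notin> W"
      using assms(1,3) by (auto simp: W_def convex_translation_eq add_eq_0_iff)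
    have len: "length ws = d" using node by (simp add: ws_def)
    have "1 \<in> W" using assms(2) by (auto simp: W_def intro!: image_eqI[of _ _ 0])
    then have "set ws \<subseteq> W" using node by (auto simp: ws_def W_def)
    then obtain w c where w: "w \<in> W" "c \<ge> 1" "prod_list ws = of_real c * w ^ d"
      using convex_prod_list[OF W, of ws] len assms(5) by auto
    obtain z where z: "z \<in> S" "w = 1 + z" using w(1) by (auto simp: W_def)
    have "prod_list ws = (\<Prod>z\<leftarrow>zs. 1 + z)" by (simp add: ws_def)
    then have "lam / (\<Prod>z\<leftarrow>zs. 1 + z) = (1 - 1 / c) *\<^sub>R 0 + (1 / c) *\<^sub>R (lam / (1 + z) ^ d)"
      using w z by (simp add: scaleR_conv_of_real)
    also have "\<dots> \<in> S"
      using w(2) by (intro convexD_alt assms z) auto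
    finally show ?case .
  qed
qed

text \<open>
  The sum \<open>1 + a + b\<close> vanishes iff the independence polynomial does so on the tree formed by
  joining the roots of the trees of \<open>a\<close> and \<open>b\<close>; the induction moves this edge towards a leaf.
\<close>
lemma tree_ratios_edge:
  assumes ne: "- 1 \<notin> tree_ratios d lam" and d: "d > 0"
    and "a \<in> tree_ratios d lam" "b \<in> tree_ratios d lam"
  shows "1 + a + b \<noteq> 0"
  using assms(3,4)
proof (induction arbitrary: b)
  case (node zs)
  have nz: "1 + z \<noteq> 0" if "z \<in> tree_ratios d lam" for z
    using ne that by (metis add_eq_0_iff)
  show ?case
  proof (cases zs)
    case Nil
    \<comment> \<open>The root of \<open>a\<close> is a leaf of the joined tree:
      \<open>1 + lam + b = (1 + b) * (1 + lam / (1 + b))\<close>.\<close>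
    have "lam / (\<Prod>z\<leftarrow>[b]. 1 + z) \<in> tree_ratios d lam"
      using node.prems d by (intro tree_ratios.node) auto
    then have "1 + lam / (1 + b) \<noteq> 0" using nz by simp
    then show ?thesis using Nil nz[OF node.prems] by (auto simp: field_simps)
  next
    case (Cons c ts)
    define p where "p = (\<Prod>z\<leftarrow>ts. 1 + z)"
    have c: "c \<in> tree_ratios d lam" using Cons node.IH by simp
    have p: "p \<noteq> 0" using Cons node.IH nz by (auto simp: p_def prod_list_zero_iff)
    \<comment> \<open>The child \<open>c\<close> is detached and \<open>b\<close> hung in its place,
      so the number of children is unchanged and the induction hypothesis for \<open>c\<close>
      applies. Clearing \<open>1 + b\<close> and \<open>1 + c\<close> turns the old and the new sum
      into the same expression, symmetric in \<open>b\<close> and \<open>c\<close>.\<close>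
    have "lam / (\<Prod>z\<leftarrow>b # ts. 1 + z) \<in> tree_ratios d lam"
      using node.prems Cons node.IH node.hyps by (intro tree_ratios.node) auto
    then have "1 + c + lam / ((1 + b) * p) \<noteq> 0"
      using Cons node.IH by (simp add: p_def)
    moreover have "(1 + c + lam / ((1 + b) * p)) * (1 + b) = (1 + c) * (1 + b) + lam / p"
      using nz[OF node.prems] by (simp add: distrib_right[of "1 + c"])
    moreover have "(1 + b + lam / ((1 + c) * p)) * (1 + c) = (1 + c) * (1 + b) + lam / p"
      using nz[OF c] by (simp add: distrib_right[of "1 + b"])
    ultimately have "1 + b + lam / ((1 + c) * p) \<noteq> 0"
      using nz[OF node.prems] by (metis mult_eq_0_iff)
    then show ?thesis using Cons by (simp add: p_def add_ac)
  qed
qed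

section \<open>The vertex recursion\<close>

text \<open>With the relation fixed and the vertex set variable, deleting vertices is set
  difference.\<close>

definition indep_sum :: "('a \<Rightarrow> 'a \<Rightarrow> bool) \<Rightarrow> complex \<Rightarrow> 'a set \<Rightarrow> complex" where
  "indep_sum E x A = (\<Sum>I | I \<subseteq> A \<and> (\<forall>u\<in>I. \<forall>v\<in>I. \<not> E u v). x ^ card I)"

lemma indep_sum_insert:
  assumes "finite A" "v \<notin> A" "\<not> E v v" "\<And>u. E u v \<longleftrightarrow> E v u"
  shows "indep_sum E x (insert v A) = indep_sum E x A + x * indep_sum E x (A - {u. E v u})"
proof -
  define F where "F B = {I. I \<subseteq> B \<and> (\<forall>u\<in>I. \<forall>w\<in>I. \<not> E u w)}" for B
  let ?B = "A - {u. E v u}"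
  have fin: "finite (F B)" if "finite B" for B
    using that by (auto simp: F_def intro: finite_subset[of _ "Pow B"])
  have split: "F (insert v A) = F A \<union> insert v ` F ?B"
  proof (intro equalityI subsetI)
    fix I assume I: "I \<in> F (insert v A)"
    show "I \<in> F A \<union> insert v ` F ?B"
    proof (cases "v \<in> I")
      case True
      then have "I = insert v (I - {v})" "I - {v} \<in> F ?B" using I by (auto simp: F_def)
      then show ?thesis by blast
    qed (use I in \<open>auto simp: F_def\<close>)
  qed (use assms(2,3) iffD1[OF assms(4)] in \<open>auto simp: F_def\<close>)
  have inj: "inj_on (insert v) (F ?B)"
    using assms(2) by (intro inj_onI) (auto simp: F_def insert_ident subset_iff)
  have disj: "F A \<inter> insert v ` F ?B = {}" using assms(2) by (auto simp: F_def)
  have "(\<Sum>I\<in>F (insert v A). x ^ card I) = (\<Sum>I\<in>F A. x ^ card I) + (\<Sum>I\<in>F ?B. x ^ card (insert v I))"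
    unfolding split using fin assms(1) disj inj
    by (subst sum.union_disjoint) (auto simp: sum.reindex)
  also have "(\<Sum>I\<in>F ?B. x ^ card (insert v I)) = (\<Sum>I\<in>F ?B. x * x ^ card I)"
  proof (rule sum.cong[OF refl])
    fix I assume "I \<in> F ?B"
    then have "I \<subseteq> A" by (auto simp: F_def)
    then have "finite I" "v \<notin> I" using assms(1,2) finite_subset by auto
    then show "x ^ card (insert v I) = x * x ^ card I" by simp
  qed
  finally show ?thesis by (simp add: indep_sum_def F_def sum_distrib_left)
qed

lemma indep_sum_empty [simp]: "indep_sum E x {} = 1"
proof -
  have "{I. I \<subseteq> {} \<and> (\<forall>u\<in>I. \<forall>v\<in>I. \<not> E u v)} = {{}}" by auto
  then show ?thesis by (simp add: indep_sum_def)
qed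

lemma indep_sum_nonzero:
  fixes E :: "'a \<Rightarrow> 'a \<Rightarrow> bool"
  assumes V: "finite V" "\<And>v. \<not> E v v" "\<And>u v. E u v \<longleftrightarrow> E v u"
    and deg: "\<And>v. v \<in> V \<Longrightarrow> card {u \<in> V. E v u} \<le> Suc d"
    and ne: "- 1 \<notin> tree_ratios d lam" and d: "d > 0"
  shows "indep_sum E lam V \<noteq> 0"
proof -
  let ?Z = "indep_sum E lam"
  let ?N = "\<lambda>v. {u. E v u}"
  let ?T = "tree_ratios d lam"
  \<comment> \<open>The second part says that \<open>v\<close>, added to \<open>A\<close>, has a
    tree ratio. It is multiplied out to avoid division. The bound \<open>d\<close> matches the
    number of children in \<open>tree_ratios\<close>.\<close>
  define good where "good A \<longleftrightarrow> ?Z A \<noteq> 0 \<and>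
    (\<forall>v\<in>V - A. card (A \<inter> ?N v) \<le> d \<longrightarrow> (\<exists>t\<in>?T. lam * ?Z (A - ?N v) = t * ?Z A))" for A
  have nz: "1 + z \<noteq> 0" if "z \<in> ?T" for z using ne that by (metis add_eq_0_iff)
  have good: "good A" if "finite A" "A \<subseteq> V" for A
    using that
  proof (induction A rule: finite_psubset_induct)
    case (psubset A)
    have step: "?Z (insert v B) = ?Z B + lam * ?Z (B - ?N v)" if "finite B" "v \<notin> B" for v B
      using indep_sum_insert[of B v E lam] that V(2,3) by simp
    \<comment> \<open>The neighbour \<open>v\<close> of \<open>u\<close> lies outside
      \<open>B\<close>, so \<open>u\<close> has at most \<open>d\<close> neighbours left in
      \<open>B - {u}\<close> and its ratio there is a tree ratio.\<close>
    have remove: "\<exists>z\<in>?T. ?Z B = ?Z (B - {u}) * (1 + z)"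
      if "B \<subseteq> A" "u \<in> B" "v \<in> V - B" "E v u" for B u v
    proof -
      have finB: "finite B" using that psubset finite_subset by blast
      have u: "u \<in> V" using that psubset by auto
      have "(B - {u}) \<inter> ?N u \<subset> {w \<in> V. E u w}"
        using that psubset.prems V(3) by blast
      then have "card ((B - {u}) \<inter> ?N u) < card {w \<in> V. E u w}"
        using V(1) by (intro psubset_card_mono) auto
      then have "card ((B - {u}) \<inter> ?N u) \<le> d" using deg[OF u] by linarith
      moreover have "good (B - {u})"
        using that psubset.prems by (intro psubset.IH) auto
      ultimately obtain z where z: "z \<in> ?T" "lam * ?Z (B - {u} - ?N u) = z * ?Z (B - {u})"
        using u unfolding good_def by blast
      have "?Z B = ?Z (B - {u}) + lam * ?Z (B - {u} - ?N u)"
        using step[of "B - {u}" u] finB that by (simp add: insert_absorb)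
      then show ?thesis using z by (auto simp: algebra_simps)
    qed
    \<comment> \<open>Vertices of \<open>C\<close> are deleted one by one. Their common neighbour
      \<open>v\<close> stays outside, so \<open>remove\<close> applies each time.\<close>
    have telescope: "\<exists>zs. set zs \<subseteq> ?T \<and> length zs = card C \<and> ?Z B = ?Z (B - C) * (\<Prod>z\<leftarrow>zs. 1 + z)"
      if "finite C" "C \<subseteq> B" "B \<subseteq> A" "v \<in> V - B" "C \<subseteq> ?N v" for B C v
      using that
    proof (induction C arbitrary: B rule: finite_induct)
      case empty
      then show ?case by (intro exI[of _ "[]"]) auto
    next
      case (insert u C)
      obtain z where z: "z \<in> ?T" "?Z B = ?Z (B - {u}) * (1 + z)"
        using remove[of B u v] insert.prems by auto
      obtain zs where zs: "set zs \<subseteq> ?T" "length zs = card C"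
        "?Z (B - {u}) = ?Z (B - {u} - C) * (\<Prod>z\<leftarrow>zs. 1 + z)"
        using insert.IH[of "B - {u}"] insert.prems insert.hyps by blast
      have "B - {u} - C = B - insert u C" by auto
      then show ?case
        using z zs insert.hyps by (intro exI[of _ "z # zs"]) auto
    qed
    have Z0: "?Z A \<noteq> 0"
    proof (cases "A = {}")
      case False
      then obtain v where v: "v \<in> A" by auto
      define B where "B = A - {v}"
      have B: "finite B" "B \<subset> A" "v \<notin> B" "v \<in> V" "B \<subseteq> A" "A = insert v B"
        using v psubset by (auto simp: B_def)
      have goodB: "good B" using B psubset by (intro psubset.IH) auto
      then have ZB: "?Z B \<noteq> 0" by (simp add: good_def)
      have ZA: "?Z A = ?Z B + lam * ?Z (B - ?N v)"
        using step[OF B(1,3)] B(6) by simp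
      show ?thesis
      proof (cases "card (B \<inter> ?N v) \<le> d")
        case True
        then obtain t where t: "t \<in> ?T" "lam * ?Z (B - ?N v) = t * ?Z B"
          using goodB B unfolding good_def by blast
        then have "?Z A = ?Z B * (1 + t)" using ZA by (simp add: algebra_simps)
        then show ?thesis using ZB nz[OF t(1)] by simp
      next
        case False
        then obtain u where u: "u \<in> B" "E v u"
          by (metis IntE all_not_in_conv card.empty le0 mem_Collect_eq)
        let ?C = "B - {u}"
        \<comment> \<open>Now \<open>v\<close> has \<open>d + 1\<close> neighbours in
          \<open>B\<close>. Setting \<open>u\<close> aside leaves \<open>d\<close>, so
          \<open>u\<close> and \<open>v\<close> both have tree ratios over \<open>?C\<close>. As
          they are adjacent, no independent set contains both, whence the factor
          \<open>1 + z + t\<close>.\<close>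
        obtain z where z: "z \<in> ?T" "?Z B = ?Z ?C * (1 + z)"
          using remove[of B u v] B u by auto
        have "card (B \<inter> ?N v) \<le> card {w \<in> V. E v w}"
          using B psubset.prems V(1) by (intro card_mono) auto
        then have "card (B \<inter> ?N v) \<le> Suc d" using deg[OF B(4)] by linarith
        moreover have "?C \<inter> ?N v = (B \<inter> ?N v) - {u}" by auto
        ultimately have "card (?C \<inter> ?N v) \<le> d" using B(1) u by simp
        moreover have "good ?C" using B psubset.prems by (intro psubset.IH) auto
        ultimately obtain t where t: "t \<in> ?T" "lam * ?Z (?C - ?N v) = t * ?Z ?C"
          using B unfolding good_def by blast
        have "?C - ?N v = B - ?N v" using u by auto
        then have "?Z A = ?Z ?C * (1 + z + t)"
          using ZA z(2) t(2) by (simp add: algebra_simps)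
        moreover have "?Z ?C \<noteq> 0" using ZB z(2) by auto
        ultimately show ?thesis using tree_ratios_edge[OF ne d z(1) t(1)] by simp
      qed
    qed simp
    moreover have "\<exists>t\<in>?T. lam * ?Z (A - ?N v) = t * ?Z A"
      if v: "v \<in> V - A" "card (A \<inter> ?N v) \<le> d" for v
    proof -
      \<comment> \<open>Deleting all neighbours of \<open>v\<close> from \<open>A\<close> exhibits
        its ratio as a node with one child per neighbour.\<close>
      obtain zs where zs: "set zs \<subseteq> ?T" "length zs = card (A \<inter> ?N v)"
        "?Z A = ?Z (A - (A \<inter> ?N v)) * (\<Prod>z\<leftarrow>zs. 1 + z)"
        using telescope[of "A \<inter> ?N v" A v] v psubset.hyps by blast
      have "A - (A \<inter> ?N v) = A - ?N v" by auto
      moreover have "(\<Prod>z\<leftarrow>zs. 1 + z) \<noteq> 0" using zs(1) nz by (auto simp: prod_list_zero_iff)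
      moreover have "lam / (\<Prod>z\<leftarrow>zs. 1 + z) \<in> ?T"
        using zs v by (intro tree_ratios.node) auto
      ultimately show ?thesis using zs(3) by (intro bexI) auto
    qed
    ultimately show "good A" by (simp add: good_def)
  qed
  then show ?thesis using V(1) by (simp add: good_def)
qed

theorem theorem4p1:
  fixes d \<Delta> :: nat and lam :: complex
  assumes "d \<ge> 2" and "\<Delta> = d + 1"
    and "\<exists>S :: complex set. convex S \<and> 0 \<in> S \<and> - 1 \<notin> S \<and> (\<forall>z\<in>S. lam / (1 + z) ^ d \<in> S)"
  shows "\<forall>G \<in> (bounded_degree_graphs \<Delta> :: ('a, 'b) pre_digraph set). indep_poly G lam \<noteq> 0"
proof
  fix G :: "('a, 'b) pre_digraph"
  assume "G \<in> bounded_degree_graphs \<Delta>"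
  then have "graph G" and deg: "\<And>v. v \<in> verts G \<Longrightarrow> out_degree G v \<le> Suc d"
    using assms(2) by (auto simp: bounded_degree_graphs_def)
  then interpret graph G by simp
  obtain S where S: "convex S" "0 \<in> S" "- 1 \<notin> S" "\<And>z. z \<in> S \<Longrightarrow> lam / (1 + z) ^ d \<in> S"
    using assms(3) by blast
  have "tree_ratios d lam \<subseteq> S"
    using tree_ratios_subset[OF S] assms(1) by simp
  then have ne: "- 1 \<notin> tree_ratios d lam" using S(3) by blast
  have card: "card {u \<in> verts G. v \<rightarrow>\<^bsub>G\<^esub> u} \<le> Suc d" if v: "v \<in> verts G" for v
  proof -
    have "{u \<in> verts G. v \<rightarrow>\<^bsub>G\<^esub> u} \<subseteq> head G ` out_arcs G v"
      by (auto simp: arcs_ends_def arc_to_ends_def out_arcs_def)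
    then have "card {u \<in> verts G. v \<rightarrow>\<^bsub>G\<^esub> u} \<le> card (out_arcs G v)"
      by (intro surj_card_le) auto
    then show ?thesis using deg[OF v] by (simp add: out_degree_def)
  qed
  have "indep_sum (\<lambda>u v. u \<rightarrow>\<^bsub>G\<^esub> v) lam (verts G) \<noteq> 0"
  proof (rule indep_sum_nonzero)
    show "\<not> v \<rightarrow>\<^bsub>G\<^esub> v" for v using adj_not_same by auto
    show "u \<rightarrow>\<^bsub>G\<^esub> v \<longleftrightarrow> v \<rightarrow>\<^bsub>G\<^esub> u" for u v
      using arcs_ends_symmetric[OF sym_arcs, of u v] arcs_ends_symmetric[OF sym_arcs, of v u]
      by (rule iffI)
    show "finite (verts G)" by simp
    show "d > 0" using assms(1) by simp
  qed (fact card ne)+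
  then show "indep_poly G lam \<noteq> 0"
    by (simp add: indep_poly_def indep_sum_def indep_set_def)
qed

end
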